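(* Let $q$ be a prime power and $\theta$ a generator of the multiplicative group $\mathbb{F}_{q^2}^*$. The graph $G_{q,\theta}$ is isomorphic to an induced subgraph of the Erd\H{o}s-R\'enyi graph $ER_q$.
   Context: Let $A(q,\theta)=\{a\in\mathbb{Z}_{q^2-1} : \theta^a-\theta\in\mathbb{F}_q\}$ (a Bose-Chowla Sidon set). $G_{q,\theta}$ is the simple graph with vertex set $\mathbb{Z}_{q^2-1}$ in which two distinct vertices $x,y$ are adjacent if and only if $x+y\in A(q,\theta)$. The Erd\H{o}s-R\'enyi graph $ER_q$ is the graph whose vertices are the points of the projective plane $PG(2,q)$ (the $1$-dimensional subspaces of $\mathbb{F}_q^3$), in which two distinct points $(x_0,x_1,x_2)$ and $(y_0,y_1,y_2)$ are adjacent if and only if $x_0y_0+x_1y_1+x_2y_2=0$. *)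

theory Defs
  imports
    "HOL-Analysis.Cartesian_Space"
    "HOL-Number_Theory.Prime_Powers"
    "Graph_Theory.Graph_Theory"
begin

text \<open>
  The fields with \<open>q\<close> and \<open>q\<^sup>2\<close> elements are types \<open>'a\<close>, \<open>'b\<close> of classes \<^class>\<open>field\<close> and
  \<^class>\<open>finite\<close>, and the inclusion of the smaller in the larger one is a field embedding
  \<open>\<iota> :: 'a \<Rightarrow> 'b\<close>. All such embeddings have the same image, the subfield with \<open>q\<close> elements.
  Simple graphs are irreflexive symmetric digraphs without parallel arcs
  (\<^locale>\<open>pair_graph\<close>), as is usual for this library.
\<close>

definition field_embedding :: "('a::field \<Rightarrow> 'b::field) \<Rightarrow> bool" where
  "field_embedding \<iota> \<longleftrightarrow>
     \<iota> 1 = 1 \<and> (\<forall>x y. \<iota> (x + y) = \<iota> x + \<iota> y) \<and> (\<forall>x y. \<iota> (x * y) = \<iota> x * \<iota> y)"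

text \<open>Residues modulo \<open>q\<^sup>2 - 1\<close> are represented by \<open>0, \<dots>, q\<^sup>2 - 2\<close>.\<close>

definition bose_chowla :: "nat \<Rightarrow> ('a::field \<Rightarrow> 'b::field) \<Rightarrow> 'b \<Rightarrow> nat set" where
  "bose_chowla q \<iota> \<theta> = {a \<in> {0..<q^2 - 1}. \<theta> ^ a - \<theta> \<in> range \<iota>}"

definition bose_chowla_graph ::
    "nat \<Rightarrow> ('a::field \<Rightarrow> 'b::field) \<Rightarrow> 'b \<Rightarrow> nat pair_pre_digraph" where
  "bose_chowla_graph q \<iota> \<theta> =
     \<lparr> pverts = {0..<q^2 - 1},
       parcs = {(x, y). x \<in> {0..<q^2 - 1} \<and> y \<in> {0..<q^2 - 1} \<and> x \<noteq> y \<and>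
                  (x + y) mod (q^2 - 1) \<in> bose_chowla q \<iota> \<theta>} \<rparr>"

definition proj_points :: "('a::field ^ 3) set set" where
  "proj_points = {P. vec.subspace P \<and> vec.dim P = 1}"

text \<open>
  Orthogonality is required of all vectors of the two lines; as it is invariant under scaling,
  this is the same as orthogonality of any choice of homogeneous coordinates.
\<close>

definition erdos_renyi_graph :: "('a::field ^ 3) set pair_pre_digraph" where
  "erdos_renyi_graph =
     \<lparr> pverts = proj_points,
       parcs = {(P, Q). P \<in> proj_points \<and> Q \<in> proj_points \<and> P \<noteq> Q \<and>
                  (\<forall>x\<in>P. \<forall>y\<in>Q. x $ 1 * y $ 1 + x $ 2 * y $ 2 + x $ 3 * y $ 3 = 0)} \<rparr>"

lemma pair_graph_bose_chowla_graph: "pair_graph (bose_chowla_graph q \<iota> \<theta>)"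
proof
  show "finite (parcs (bose_chowla_graph q \<iota> \<theta>))"
    by (rule finite_subset[of _ "{0..<q^2 - 1} \<times> {0..<q^2 - 1}"])
      (auto simp: bose_chowla_graph_def)
  show "symmetric (with_proj (bose_chowla_graph q \<iota> \<theta>))"
    by (auto simp: symmetric_def sym_def bose_chowla_graph_def add.commute)
qed (auto simp: bose_chowla_graph_def)

lemma pair_graph_erdos_renyi_graph:
  "pair_graph (erdos_renyi_graph :: ('a::{field,finite} ^ 3) set pair_pre_digraph)"
proof
  show "symmetric (with_proj (erdos_renyi_graph :: ('a ^ 3) set pair_pre_digraph))"
    unfolding symmetric_def with_proj_simps
    by (rule symI) (simp add: erdos_renyi_graph_def, metis mult.commute)
qed (auto simp: erdos_renyi_graph_def)

definition iso_to_induced_subgraph :: "'v pair_pre_digraph \<Rightarrow> 'w pair_pre_digraph \<Rightarrow> bool" where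
  "iso_to_induced_subgraph G K \<longleftrightarrow>
     (\<exists>H. induced_subgraph H (with_proj K) \<and> digraph_iso (with_proj G) H)"

end

theory Submission
  imports Defs
begin

text \<open>
  Let \<open>\<theta>\<^sup>2 = n + t\<theta>\<close>. For \<open>u = a + b\<theta>\<close> and \<open>v = c + d\<theta>\<close> the \<open>\<theta>\<close>-coordinate of \<open>u v\<close> is
  \<open>ad + bc + tbd\<close>, so \<open>x + y \<in> A(q, \<theta>)\<close> says that this symmetric bilinear form takes the value
  \<open>1\<close> at \<open>(\<theta>\<^sup>x, \<theta>\<^sup>y)\<close>, i.e. that the homogenised form \<open>ad + bc + tbd - zw\<close> vanishes at
  \<open>((\<theta>\<^sup>x, 1), (\<theta>\<^sup>y, 1))\<close>. The ternary form has determinant \<open>1\<close> and is congruent to the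
  standard dot product over the field with \<open>q\<close> elements: for odd \<open>q\<close> this uses a solution of
  \<open>\<alpha>\<^sup>2 + \<beta>\<^sup>2 = -1\<close>, and for even \<open>q\<close> it uses \<open>t \<noteq> 0\<close> and a square root of \<open>t\<close>. Mapping \<open>x\<close> to the line
  spanned by the image of \<open>(\<theta>\<^sup>x, 1)\<close> under such a congruence is the required embedding.
\<close>

section \<open>Recognising induced subgraphs\<close>

text \<open>The image of \<open>G\<close> under \<open>f\<close> serves as the induced subgraph: by
  \<open>arc\<close>, its arcs are all arcs of \<open>K\<close> between image vertices.\<close>

lemma iso_to_induced_subgraphI:
  assumes "pair_wf_digraph G" "pair_wf_digraph K"
    and inj: "inj_on f (pverts G)" and sub: "f ` pverts G \<subseteq> pverts K"
    and arc: "\<And>x y. x \<in> pverts G \<Longrightarrow> y \<in> pverts G \<Longrightarrow> (x, y) \<in> parcs G \<longleftrightarrow> (f x, f y) \<in> parcs K"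
  shows "iso_to_induced_subgraph G K"
proof -
  interpret G: pair_wf_digraph G by fact
  interpret K: pair_wf_digraph K by fact
  \<comment> \<open>Arcs are pairs, so they move by \<open>map_prod f f\<close>; keeping
    \<open>fst\<close> and \<open>snd\<close> as tail and head makes the image compatible with
    \<open>with_proj K\<close>.\<close>
  define h where "h = \<lparr> iso_verts = f, iso_arcs = map_prod f f, iso_head = snd, iso_tail = fst \<rparr>"
  have par: "parcs G \<subseteq> pverts G \<times> pverts G"
    by (auto dest: G.wellformed')
  have "inj_on (map_prod f f) (parcs G)"
    using map_prod_inj_on[OF inj inj] par by (rule inj_on_subset)
  then have h: "pre_digraph.digraph_isomorphism (with_proj G) h"
    using inj G.wf_digraph by (auto simp: pre_digraph.digraph_isomorphism_def h_def)
  have app: "app_iso h (with_proj G) =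
      \<lparr> verts = f ` pverts G, arcs = map_prod f f ` parcs G, tail = fst, head = snd \<rparr>"
    by (simp add: app_iso_def h_def)
  have "map_prod f f ` parcs G = {e \<in> parcs K. fst e \<in> f ` pverts G \<and> snd e \<in> f ` pverts G}"
    using arc par by (force simp: image_iff)
  moreover have "wf_digraph (app_iso h (with_proj G))"
    using h by (rule G.wf_digraphI_app_iso)
  ultimately have "induced_subgraph (app_iso h (with_proj G)) (with_proj K)"
    using sub K.wf_digraph
    by (auto simp: induced_subgraph_def subgraph_def compatible_def app)
  with h show ?thesis
    by (auto simp: iso_to_induced_subgraph_def digraph_iso_def)
qed

section \<open>Squares in finite fields\<close>

text \<open>Pigeonhole: more than half of the field elements are squares, so the set
  \<open>S\<close> of squares meets its reflection \<open>-1 - S\<close>.\<close>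

lemma sum_two_squares_minus_one:
  obtains \<alpha> \<beta> :: "'a::{field,finite}" where "\<alpha>^2 + \<beta>^2 = -1"
proof -
  define S where "S = range (\<lambda>x::'a. x^2)"
  define r where "r = inv (\<lambda>x::'a. x^2)"
  have r: "r (x^2) = x \<or> r (x^2) = -x" for x
    using f_inv_into_f[of "x^2" "\<lambda>x. x^2" UNIV] by (auto simp: r_def power2_eq_iff)
  \<comment> \<open>Each element is the chosen root of its square or the negative of that root. As 0
    needs no second root, the bound on \<open>CARD('a)\<close> is strictly below
    \<open>card S + card S\<close>.\<close>
  have cover: "UNIV \<subseteq> r ` S \<union> (\<lambda>y. - r y) ` (S - {0})"
  proof
    fix x :: 'a
    show "x \<in> r ` S \<union> (\<lambda>y. - r y) ` (S - {0})"
    proof (cases "r (x^2) = x")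
      case True
      then show ?thesis by (metis S_def UnI1 image_eqI rangeI)
    next
      case False
      with r[of x] have neg: "x = - r (x^2)" by auto
      then have "x \<noteq> 0" using False by auto
      then have "x^2 \<in> S - {0}" by (simp add: S_def)
      then show ?thesis using neg by blast
    qed
  qed
  have S0: "0 \<in> S" unfolding S_def by (rule range_eqI[of _ _ 0]) simp
  have "CARD('a) \<le> card (r ` S \<union> (\<lambda>y. - r y) ` (S - {0}))"
    using cover by (intro card_mono) auto
  also have "\<dots> \<le> card (r ` S) + card ((\<lambda>y. - r y) ` (S - {0}))"
    by (rule card_Un_le)
  also have "\<dots> \<le> card S + card (S - {0})"
    by (intro add_mono card_image_le) auto
  also have "\<dots> < card S + card S"
    by (rule add_strict_left_mono[OF card_Diff1_less[OF finite S0]])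
  also have "card S + card S = card S + card ((\<lambda>y. -1 - y) ` S)"
    by (simp add: card_image inj_on_def)
  finally have "CARD('a) < card S + card ((\<lambda>y. -1 - y) ` S)" .
  then have "S \<inter> (\<lambda>y. -1 - y) ` S \<noteq> {}"
    using card_Un_disjoint[of S "(\<lambda>y. -1 - y) ` S"] card_mono[of UNIV "S \<union> (\<lambda>y. -1 - y) ` S"]
    by force
  then obtain \<alpha> \<beta> :: 'a where "\<alpha>^2 = -1 - \<beta>^2"
    by (auto simp: S_def)
  then have "\<alpha>^2 + \<beta>^2 = -1" by simp
  then show ?thesis by (rule that)
qed

text \<open>In characteristic 2, \<open>x^2 = y^2\<close> forces \<open>(x - y)^2 = 0\<close>, so
  squaring is injective and, by finiteness, surjective.\<close>

lemma char_2_square_root: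
  fixes a :: "'a::{field,finite}"
  assumes "(2::'a) = 0"
  obtains s where "s^2 = a"
proof -
  have "inj (\<lambda>x::'a. x^2)"
  proof (rule injI)
    fix x y :: 'a assume "x^2 = y^2"
    then have "(x - y)^2 = 2 * (y^2 - x * y)" by (simp add: power2_diff algebra_simps)
    then show "x = y" using assms by simp
  qed
  then have "surj (\<lambda>x::'a. x^2)" by (rule finite_UNIV_inj_surj[OF finite])
  then show ?thesis using that by (metis surjD)
qed

section \<open>The ternary form and the dot product\<close>

definition dot3 :: "'a::field ^ 3 \<Rightarrow> 'a ^ 3 \<Rightarrow> 'a" where
  "dot3 x y = x $ 1 * y $ 1 + x $ 2 * y $ 2 + x $ 3 * y $ 3"

lemma dot3_simps:
  "dot3 (x + y) z = dot3 x z + dot3 y z" "dot3 z (x + y) = dot3 z x + dot3 z y"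
  "dot3 (c *s x) z = c * dot3 x z" "dot3 z (c *s x) = c * dot3 z x"
  "dot3 0 z = 0"
  by (simp_all add: dot3_def algebra_simps)

lemma dot3_commute: "dot3 x y = dot3 y x"
  by (simp add: dot3_def mult.commute)

text \<open>The six values form the Gram matrix of \<open>ad + bc + tbd - zw\<close>, so these
  vectors carry that form to the dot product. That image points exist and are distinct is later read
  off from the same values.\<close>

lemma dot3_basis_exists:
  fixes t :: "'a::{field,finite}"
  assumes "(2::'a) = 0 \<Longrightarrow> t \<noteq> 0"
  obtains e1 e2 e3 :: "'a ^ 3" where
    "dot3 e1 e1 = 0" "dot3 e1 e2 = 1" "dot3 e2 e2 = t"
    "dot3 e1 e3 = 0" "dot3 e2 e3 = 0" "dot3 e3 e3 = -1"
proof (cases "(2::'a) = 0")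
  case True
  then obtain s where s: "s^2 = t" by (rule char_2_square_root)
  with True assms have "s \<noteq> 0" by auto
  have "(1::'a) + 1 = 0" using True by simp
  then have "inverse s * inverse s + inverse s * inverse s = 0" "(1::'a) = -1"
    by (metis distrib_left mult.right_neutral mult_zero_right, metis eq_neg_iff_add_eq_0)
  \<comment> \<open>The two equal entries of \<open>e1\<close> have squares that cancel in
    characteristic 2; \<open>inverse s\<close> against \<open>s\<close> gives 1, \<open>s^2\<close>
    is \<open>t\<close>, and \<open>e3\<close> has norm 1 = -1.\<close>
  then show ?thesis
    using that[of "vector [0, inverse s, inverse s]" "vector [0, s, 0]" "vector [1, 0, 0]"]
      \<open>s \<noteq> 0\<close> s by (simp add: dot3_def vector_3 power2_eq_square)
next
  case False
  obtain \<alpha> \<beta> :: 'a where ab: "\<alpha>^2 + \<beta>^2 = -1" by (rule sum_two_squares_minus_one)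
  \<comment> \<open>For the witnesses below, \<open>dot3 e1 e1 = 0\<close> by the choice of \<alpha>
    and \<beta>, while \<open>dot3 e1 e2\<close> is \<open>s - r\<close> and
    \<open>dot3 e2 e2\<close> is \<open>s^2 - r^2\<close>. Hence \<open>s\<close> and
    \<open>r\<close> solve \<open>s - r = 1\<close> and \<open>s + r = t\<close>.\<close>
  define s r where "s = (t + 1) / 2" and "r = (t - 1) / 2"
  have sr: "s - r = 1" "s + r = t"
    using False by (simp_all add: s_def r_def diff_divide_distrib add_divide_distrib)
  show ?thesis
  proof (rule that[of "vector [- \<beta>, \<alpha>, 1]" "vector [- r * \<beta>, r * \<alpha>, s]" "vector [\<alpha>, \<beta>, 0]"])
    show "dot3 (vector [- \<beta>, \<alpha>, 1]) (vector [- \<beta>, \<alpha>, 1]) = 0"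
      and "dot3 (vector [\<alpha>, \<beta>, 0]) (vector [\<alpha>, \<beta>, 0]) = -1"
      using ab by (simp_all add: dot3_def vector_3 power2_eq_square algebra_simps)
    have "dot3 (vector [- \<beta>, \<alpha>, 1]) (vector [- r * \<beta>, r * \<alpha>, s]) = r * (\<alpha>^2 + \<beta>^2) + s"
      by (simp add: dot3_def vector_3 power2_eq_square algebra_simps)
    then show "dot3 (vector [- \<beta>, \<alpha>, 1]) (vector [- r * \<beta>, r * \<alpha>, s]) = 1"
      using ab sr(1) by simp
    have "dot3 (vector [- r * \<beta>, r * \<alpha>, s]) (vector [- r * \<beta>, r * \<alpha>, s])
        = r^2 * (\<alpha>^2 + \<beta>^2) + s^2"
      by (simp add: dot3_def vector_3 power2_eq_square algebra_simps)
    also have "\<dots> = (s - r) * (s + r)"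
      unfolding ab by (simp add: power2_eq_square algebra_simps)
    finally show "dot3 (vector [- r * \<beta>, r * \<alpha>, s]) (vector [- r * \<beta>, r * \<alpha>, s]) = t"
      using sr by simp
  qed (simp_all add: dot3_def vector_3 algebra_simps)
qed

section \<open>Points of the projective plane\<close>

lemma span_singleton_in_proj_points: "v \<noteq> 0 \<Longrightarrow> vec.span {v} \<in> proj_points"
  by (simp add: proj_points_def)

text \<open>By bilinearity one spanning vector of each line decides orthogonality. The lines are
  still compared, since a nonzero vector may be orthogonal to itself.\<close>

lemma erdos_renyi_adjacent_span_iff:
  assumes "u \<noteq> 0" "v \<noteq> 0"
  shows "(vec.span {u}, vec.span {v}) \<in> parcs erdos_renyi_graph \<longleftrightarrow>
    vec.span {u} \<noteq> vec.span {v} \<and> dot3 u v = 0"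
proof -
  have "(\<forall>x\<in>vec.span {u}. \<forall>y\<in>vec.span {v}. dot3 x y = 0) \<longleftrightarrow> dot3 u v = 0"
    by (auto simp: vec.span_singleton dot3_simps vec.span_base)
  then show ?thesis
    using assms by (simp add: erdos_renyi_graph_def span_singleton_in_proj_points dot3_def)
qed

section \<open>Powers of a generator\<close>

text \<open>Multiplication by \<open>x\<close> permutes the nonzero elements, so their nonzero
  product absorbs the power of \<open>x\<close>.\<close>

lemma finite_field_power_eq_1:
  fixes x :: "'b::{field,finite}"
  assumes "x \<noteq> 0"
  shows "x ^ (CARD('b) - 1) = 1"
proof -
  have "(\<Prod>y\<in>UNIV - {0}. y) = (\<Prod>y\<in>UNIV - {0}. x * y)"
    by (rule prod.reindex_bij_witness[of _ "\<lambda>y. x * y" "\<lambda>y. y / x"]) (use assms in auto)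
  also have "\<dots> = x ^ (CARD('b) - 1) * (\<Prod>y\<in>UNIV - {0}. y)"
    by (simp add: prod.distrib)
  finally show ?thesis by simp
qed

text \<open>Counting: the exponents in this interval already reach every nonzero element, and there
  are as many exponents as such elements.\<close>

lemma power_inj_on_generator:
  fixes \<theta> :: "'b::{field,finite}"
  assumes gen: "range (\<lambda>k::int. \<theta> powi k) = UNIV - {0}" and "\<theta> \<noteq> 0"
  shows "inj_on (\<lambda>k. \<theta> ^ k) {0..<CARD('b) - 1}"
proof -
  define N where "N = CARD('b) - 1"
  have "card {0, 1 :: 'b} \<le> CARD('b)" by (rule card_mono) auto
  then have N: "N > 0" by (simp add: N_def)
  have one: "\<theta> ^ N = 1" unfolding N_def by (rule finite_field_power_eq_1) fact
  have "UNIV - {0} \<subseteq> (\<lambda>k. \<theta> ^ k) ` {0..<N}"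
  proof
    fix x assume "x \<in> UNIV - {0 :: 'b}"
    then obtain k :: int where "x = \<theta> powi k" using gen by blast
    \<comment> \<open>The remainder is nonnegative even for negative \<open>k\<close>, so an integer
      power becomes a natural one with exponent below \<open>N\<close>.\<close>
    also have "k = int N * (k div int N) + int (nat (k mod int N))"
      using N by simp
    also have "\<theta> powi \<dots> = \<theta> ^ nat (k mod int N)"
      unfolding power_int_add[OF disjI1[OF \<open>\<theta> \<noteq> 0\<close>]] power_int_mult power_int_of_nat one by simp
    finally show "x \<in> (\<lambda>k. \<theta> ^ k) ` {0..<N}"
      using N by (simp add: nat_less_iff)
  qed
  then have "card (UNIV - {0::'b}) \<le> card ((\<lambda>k. \<theta> ^ k) ` {0..<N})"
    by (intro card_mono) auto
  moreover have "card (UNIV - {0::'b}) = N" by (simp add: N_def)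
  moreover have "card ((\<lambda>k. \<theta> ^ k) ` {0..<N}) \<le> N"
    using card_image_le[of "{0..<N}" "\<lambda>k. \<theta> ^ k"] by simp
  ultimately show ?thesis
    unfolding N_def[symmetric] by (intro eq_card_imp_inj_on) auto
qed

section \<open>The embedded subfield and the basis 1, \<theta>\<close>

context
  fixes \<iota> :: "'a::field \<Rightarrow> 'b::field"
  assumes emb: "field_embedding \<iota>"
begin

lemma field_embedding_simps:
  "\<iota> 1 = 1" "\<iota> (x + y) = \<iota> x + \<iota> y" "\<iota> (x * y) = \<iota> x * \<iota> y"
  "\<iota> 0 = 0" "\<iota> (- x) = - \<iota> x" "\<iota> (x - y) = \<iota> x - \<iota> y"
proof -
  show *: "\<iota> 1 = 1" "\<iota> (x + y) = \<iota> x + \<iota> y" "\<iota> (x * y) = \<iota> x * \<iota> y" for x y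
    using emb by (auto simp: field_embedding_def)
  show **: "\<iota> 0 = 0" by (metis *(2) add_0 add_cancel_right_left)
  show ***: "\<iota> (- x) = - \<iota> x" for x using *(2)[of x "- x"] ** by (simp add: eq_neg_iff_add_eq_0 add.commute)
  show "\<iota> (x - y) = \<iota> x - \<iota> y" using *(2)[of x "- y"] *** by simp
qed

lemma field_embedding_eq_0_iff: "\<iota> x = 0 \<longleftrightarrow> x = 0"
proof
  assume "\<iota> x = 0"
  show "x = 0"
  proof (rule ccontr)
    assume "x \<noteq> 0"
    then have "\<iota> (x * inverse x) = 1" by (simp add: field_embedding_simps)
    then show False using \<open>\<iota> x = 0\<close> by (simp only: field_embedding_simps) simp
  qed
qed (simp add: field_embedding_simps)

lemma inj_field_embedding: "inj \<iota>"
  by (rule injI) (metis field_embedding_eq_0_iff field_embedding_simps(6) right_minus_eq)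

lemma field_embedding_inverse: "\<iota> (inverse x) = inverse (\<iota> x)"
proof (cases "x = 0")
  case False
  then have "\<iota> x * \<iota> (inverse x) = 1"
    by (simp flip: field_embedding_simps(1,3))
  then show ?thesis by (metis inverse_unique)
qed (simp add: field_embedding_simps)

lemma field_embedding_power: "\<iota> (x ^ k) = \<iota> x ^ k"
  by (induction k) (simp_all add: field_embedding_simps)

lemma field_embedding_power_int: "\<iota> (x powi k) = \<iota> x powi k"
  by (simp add: power_int_def field_embedding_power field_embedding_inverse)

text \<open>Linear independence of 1 and \<theta> over the subfield: for nonzero \<open>b\<close>,
  division by \<open>\<iota> b\<close> would put \<theta> into it.\<close>

lemma combination_in_range_iff:
  assumes "\<theta> \<notin> range \<iota>"
  shows "\<iota> a + \<iota> b * \<theta> \<in> range \<iota> \<longleftrightarrow> b = 0"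
proof
  assume "\<iota> a + \<iota> b * \<theta> \<in> range \<iota>"
  then obtain c where c: "\<iota> b * \<theta> = \<iota> (c - a)"
    by (auto simp: field_embedding_simps algebra_simps)
  show "b = 0"
  proof (rule ccontr)
    assume "b \<noteq> 0"
    then have "\<theta> = \<iota> (inverse b * (c - a))"
      using c field_embedding_eq_0_iff[of b]
      by (simp add: field_embedding_simps(3) field_embedding_inverse flip: c)
    with assms show False by blast
  qed
qed (simp add: field_embedding_simps)

end

text \<open>By independence, pairs of coordinates map injectively into a field with equally many
  elements, hence onto it.\<close>

lemma coordinates_exist:
  fixes \<iota> :: "'a::{field,finite} \<Rightarrow> 'b::{field,finite}"
  assumes "CARD('b) = CARD('a)^2" and emb: "field_embedding \<iota>" and "\<theta> \<notin> range \<iota>"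
  obtains A B where "\<And>u. u = \<iota> (A u) + \<iota> (B u) * \<theta>"
proof -
  define g where "g = (\<lambda>(a, b). \<iota> a + \<iota> b * \<theta>)"
  have "inj g"
  proof (rule injI)
    fix p p' assume "g p = g p'"
    then obtain a b c d where p: "p = (a, b)" "p' = (c, d)"
      and eq: "\<iota> a + \<iota> b * \<theta> = \<iota> c + \<iota> d * \<theta>"
      by (cases p, cases p') (auto simp: g_def)
    then have "\<iota> (a - c) + \<iota> (b - d) * \<theta> = 0"
      by (simp add: field_embedding_simps[OF emb] algebra_simps)
    moreover have "0 \<in> range \<iota>"
      using field_embedding_simps(4)[OF emb] by (metis rangeI)
    ultimately have "b - d = 0"
      using combination_in_range_iff[OF emb assms(3), of "a - c" "b - d"] by simp
    with eq have "\<iota> a = \<iota> c" by simp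
    then have "a = c" using inj_field_embedding[OF emb] by (auto dest: injD)
    with p \<open>b - d = 0\<close> show "p = p'" by simp
  qed
  then have "card (range g) = CARD('b)"
    using assms(1) by (simp add: card_image power2_eq_square)
  then have surj: "surj g" by (simp add: card_eq_UNIV_imp_eq_UNIV)
  then have "u = \<iota> (fst (inv g u)) + \<iota> (snd (inv g u)) * \<theta>" for u
    using surj_f_inv_f[OF surj, of u] by (simp add: g_def split: prod.splits)
  then show ?thesis by (rule that)
qed

lemma generator_nonzero:
  fixes \<theta> :: "'b::field"
  assumes "range (\<lambda>k::int. \<theta> powi k) = UNIV - {0}"
  shows "\<theta> \<noteq> 0"
proof -
  have "\<theta> powi 1 \<in> UNIV - {0}" using assms by blast
  then show ?thesis by simp
qed

text \<open>Otherwise all powers of \<theta>, hence the whole larger field, would lie in the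
  subfield.\<close>

lemma generator_notin_range:
  fixes \<iota> :: "'a::{field,finite} \<Rightarrow> 'b::{field,finite}"
  assumes "CARD('a) < CARD('b)" and emb: "field_embedding \<iota>"
    and gen: "range (\<lambda>k::int. \<theta> powi k) = UNIV - {0}"
  shows "\<theta> \<notin> range \<iota>"
proof
  assume "\<theta> \<in> range \<iota>"
  then obtain c where c: "\<theta> = \<iota> c" by blast
  have "x \<in> range \<iota>" for x
  proof (cases "x = 0")
    case True
    then show ?thesis using field_embedding_simps(4)[OF emb] by (metis rangeI)
  next
    case False
    then obtain k :: int where "x = \<theta> powi k" using gen by blast
    then show ?thesis by (simp add: c flip: field_embedding_power_int[OF emb])
  qed
  then have "CARD('b) \<le> CARD('a)"
    using card_image_le[of UNIV \<iota>] by (metis UNIV_eq_I finite)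
  with assms(1) show False by simp
qed

text \<open>Supplies the hypothesis of \<open>dot3_basis_exists\<close>. If \<open>t\<close> were 0,
  then \<open>\<theta>^2\<close> would be the square of some \<open>\<iota> m\<close>, placing
  \<theta> in the subfield.\<close>

lemma quadratic_trace_nonzero_char_2:
  fixes \<iota> :: "'a::{field,finite} \<Rightarrow> 'b::field"
  assumes emb: "field_embedding \<iota>" and "\<theta> \<notin> range \<iota>" and "(2::'a) = 0"
    and sq: "\<theta>^2 = \<iota> n + \<iota> t * \<theta>"
  shows "t \<noteq> 0"
proof
  assume "t = 0"
  obtain m where "m^2 = n" using assms(3) by (rule char_2_square_root)
  with sq \<open>t = 0\<close> have "\<theta>^2 = (\<iota> m)^2"
    by (simp add: field_embedding_simps[OF emb] flip: field_embedding_power[OF emb])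
  then have "\<theta> = \<iota> m \<or> \<theta> = \<iota> (- m)"
    by (simp add: power2_eq_iff field_embedding_simps[OF emb])
  with assms(2) show False by blast
qed

section \<open>Embedding the Bose-Chowla graph\<close>

theorem theorem1p2:
  fixes q :: nat
    and \<iota> :: "'a::{field,finite} \<Rightarrow> 'b::{field,finite}"
    and \<theta> :: 'b
  assumes "primepow q"
    and "CARD('a) = q"
    and "CARD('b) = q^2"
    and "field_embedding \<iota>"
    and "range (\<lambda>k::int. \<theta> powi k) = UNIV - {0}"
  shows "iso_to_induced_subgraph (bose_chowla_graph q \<iota> \<theta>)
           (erdos_renyi_graph :: ('a ^ 3) set pair_pre_digraph)"
proof -
  note emb = assms(4) and gen = assms(5)
  note \<iota> = field_embedding_simps[OF emb]
  have "q > 1" using primepow_gt_Suc_0[OF assms(1)] by simp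
  then have "CARD('a) < CARD('b)"
    using assms(2,3) by (simp add: power2_eq_square)
  then have notin: "\<theta> \<notin> range \<iota>" by (rule generator_notin_range[OF _ emb gen])
  have "\<theta> \<noteq> 0" using gen by (rule generator_nonzero)
  obtain A B where AB: "u = \<iota> (A u) + \<iota> (B u) * \<theta>" for u
    using coordinates_exist[OF _ emb notin] assms(2,3) by metis
  define n t where "n = A (\<theta>^2)" and "t = B (\<theta>^2)"
  have sq: "\<theta>^2 = \<iota> n + \<iota> t * \<theta>" unfolding n_def t_def by (rule AB)
  obtain e1 e2 e3 :: "'a ^ 3" where e: "dot3 e1 e1 = 0" "dot3 e1 e2 = 1" "dot3 e2 e2 = t"
    "dot3 e1 e3 = 0" "dot3 e2 e3 = 0" "dot3 e3 e3 = -1"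
    using dot3_basis_exists quadratic_trace_nonzero_char_2[OF emb notin _ sq] by metis
  have e': "dot3 e2 e1 = 1" "dot3 e3 e1 = 0" "dot3 e3 e2 = 0"
    using e by (simp_all add: dot3_commute)
  \<comment> \<open>This is the image of \<open>(u, 1)\<close>; the coefficient 1 of
    \<open>e3\<close> turns the term \<open>-zw\<close> into the constant -1.\<close>
  define P where "P u = A u *s e1 + B u *s e2 + e3" for u
  define f where "f x = vec.span {P (\<theta> ^ x)}" for x :: nat
  \<comment> \<open>Pairing with the basis recovers both coordinates of \<open>u\<close>. The
    constant -1 shows that \<open>P u\<close> is nonzero and forces the scalar between proportional
    \<open>P u\<close> and \<open>P v\<close> to be 1.\<close>
  have coords: "dot3 (P u) e3 = -1" "dot3 (P u) e1 = B u" "dot3 (P u) e2 = A u + t * B u" for u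
    using e e' by (simp_all add: P_def dot3_simps mult.commute)
  have P_dot: "dot3 (P u) (P v) = A u * B v + B u * A v + t * B u * B v - 1" for u v
    using e e' by (simp add: P_def dot3_simps algebra_simps)
  have P_nz: "P u \<noteq> 0" for u
    using coords(1)[of u] by (auto simp: dot3_simps)
  have P_inj: "u = v" if "vec.span {P u} = vec.span {P v}" for u v
  proof -
    have "P u \<in> vec.span {P v}" using that by (metis singletonI vec.span_base)
    then obtain c where c: "P u = c *s P v" by (auto simp: vec.span_singleton)
    from coords(1)[of u] coords(1)[of v] have "c = 1" by (simp add: c dot3_simps)
    with c have "P u = P v" by simp
    with coords(2,3)[of u] coords(2,3)[of v] have "A u = A v" "B u = B v" by auto
    then show "u = v" using AB[of u] AB[of v] by simp
  qed
  \<comment> \<open>The \<theta>-coordinate of \<open>u * v - \<theta>\<close> is exactly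
    \<open>dot3 (P u) (P v)\<close>: \<open>t\<close> enters by reducing \<open>\<theta>^2\<close>,
    and -1 comes from the subtracted \<theta>.\<close>
  have prod_iff: "u * v - \<theta> \<in> range \<iota> \<longleftrightarrow> dot3 (P u) (P v) = 0" for u v
  proof -
    have "u * v - \<theta> = (\<iota> (A u) + \<iota> (B u) * \<theta>) * (\<iota> (A v) + \<iota> (B v) * \<theta>) - \<theta>"
      using AB[of u] AB[of v] by simp
    also have "\<dots> = \<iota> (A u) * \<iota> (A v) + (\<iota> (A u) * \<iota> (B v) + \<iota> (B u) * \<iota> (A v) - 1) * \<theta>
        + \<iota> (B u) * \<iota> (B v) * \<theta>^2"
      by (simp add: power2_eq_square algebra_simps)
    also have "\<dots> = \<iota> (A u * A v + n * B u * B v) + \<iota> (dot3 (P u) (P v)) * \<theta>"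
      unfolding sq P_dot by (simp add: \<iota> algebra_simps)
    finally show ?thesis by (simp add: combination_in_range_iff[OF emb notin])
  qed
  have inj: "inj_on (\<lambda>k. \<theta> ^ k) {0..<q^2 - 1}"
    using power_inj_on_generator[OF gen \<open>\<theta> \<noteq> 0\<close>] assms(3) by simp
  have one: "\<theta> ^ (q^2 - 1) = 1"
    using finite_field_power_eq_1[OF \<open>\<theta> \<noteq> 0\<close>] assms(3) by simp
  have pow_mod: "\<theta> ^ (k mod (q^2 - 1)) = \<theta> ^ k" for k
  proof -
    have "\<theta> ^ k = \<theta> ^ ((q^2 - 1) * (k div (q^2 - 1)) + k mod (q^2 - 1))" by simp
    also have "\<dots> = \<theta> ^ (k mod (q^2 - 1))"
      unfolding power_add power_mult one by simp
    finally show ?thesis by simp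
  qed
  have f_inj: "inj_on f {0..<q^2 - 1}"
    using inj by (auto simp: inj_on_def f_def dest: P_inj)
  show ?thesis
  proof (rule iso_to_induced_subgraphI[of _ _ f])
    show "pair_wf_digraph (bose_chowla_graph q \<iota> \<theta>)"
    proof -
      interpret pair_graph "bose_chowla_graph q \<iota> \<theta>" by (rule pair_graph_bose_chowla_graph)
      show ?thesis by unfold_locales
    qed
    show "pair_wf_digraph (erdos_renyi_graph :: ('a ^ 3) set pair_pre_digraph)"
    proof -
      interpret pair_graph "erdos_renyi_graph :: ('a ^ 3) set pair_pre_digraph"
        by (rule pair_graph_erdos_renyi_graph)
      show ?thesis by unfold_locales
    qed
    show "inj_on f (pverts (bose_chowla_graph q \<iota> \<theta>))"
      using f_inj by (simp add: bose_chowla_graph_def)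
    show "f ` pverts (bose_chowla_graph q \<iota> \<theta>) \<subseteq> pverts erdos_renyi_graph"
      by (auto simp: f_def erdos_renyi_graph_def span_singleton_in_proj_points P_nz)
  next
    fix x y
    assume "x \<in> pverts (bose_chowla_graph q \<iota> \<theta>)" "y \<in> pverts (bose_chowla_graph q \<iota> \<theta>)"
    then have xy: "x \<in> {0..<q^2 - 1}" "y \<in> {0..<q^2 - 1}"
      by (simp_all add: bose_chowla_graph_def)
    then have "(x + y) mod (q^2 - 1) \<in> bose_chowla q \<iota> \<theta> \<longleftrightarrow>
        \<theta> ^ ((x + y) mod (q^2 - 1)) - \<theta> \<in> range \<iota>"
      by (simp add: bose_chowla_def)
    also have "\<dots> \<longleftrightarrow> \<theta> ^ x * \<theta> ^ y - \<theta> \<in> range \<iota>"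
      unfolding pow_mod power_add ..
    finally have "(x, y) \<in> parcs (bose_chowla_graph q \<iota> \<theta>) \<longleftrightarrow>
        x \<noteq> y \<and> \<theta> ^ x * \<theta> ^ y - \<theta> \<in> range \<iota>"
      using xy by (simp add: bose_chowla_graph_def)
    \<comment> \<open>Both graphs exclude loops; injectivity of \<open>f\<close> makes the two
      exclusions agree.\<close>
    also have "\<dots> \<longleftrightarrow> f x \<noteq> f y \<and> dot3 (P (\<theta> ^ x)) (P (\<theta> ^ y)) = 0"
      using inj_on_eq_iff[OF f_inj xy] by (simp add: prod_iff)
    also have "\<dots> \<longleftrightarrow> (f x, f y) \<in> parcs erdos_renyi_graph"
      unfolding f_def by (rule erdos_renyi_adjacent_span_iff[symmetric]) (rule P_nz)+
    finally show "(x, y) \<in> parcs (bose_chowla_graph q \<iota> \<theta>) \<longleftrightarrow> (f x, f y) \<in> parcs erdos_renyi_graph" .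
  qed
qed

end
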